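(* Let $\mathfrak{Z}$ be an $\mathbb{F}$-Fréchet space and $(M,\mathcal{M})$ a measurable space. Suppose that $(\gamma_k)_{k\in\mathbb{N}}$ is a sequence in $\mathcal{I}(\xi)$ for an integrator $\xi:\mathcal{M}\to\mathfrak{Z}'$ with measure $\mu$ and map $\Xi$. Assume that there exists a $\gamma:M\to\mathfrak{Z}'$ such that the following holds: (1) for any $z\in\mathfrak{Z}$, $x\mapsto\langle\Xi(\gamma)(x),z\rangle$ is $\mu$-measurable; (2) for $\mu$-a.e. $x\in M$, $\Xi(\gamma_k)(x)\to\Xi(\gamma)(x)$ in $(\mathfrak{Z}',\sigma(\mathfrak{Z}',\mathfrak{Z}))$ as $k\to\infty$; (3) for any $z\in\mathfrak{Z}$ there exists $0\leq g^z\in L^1(\mu)$ such that, for every $k\in\mathbb{N}$, $|\langle\Xi(\gamma_k)(x),z\rangle|\leq g^z(x)$ for $\mu$-a.e. $x\in M$. Then $\gamma\in\mathcal{I}(\xi)$ and $$\int_M\gamma_k(x)\,d\xi(x)\to\int_M\gamma(x)\,d\xi(x)$$ in $(\mathfrak{Z}',\sigma(\mathfrak{Z}',\mathfrak{Z}))$ as $k\to\infty$.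
   Context: $\mathbb{F}\in\{\mathbb{R},\mathbb{C}\}$. A Fréchet space is a metrizable, complete, locally convex topological vector space over $\mathbb{F}$; $\mathfrak{Z}'$ is its topological dual and $\langle z',z\rangle$ the dual pairing. $\sigma(\mathfrak{Z}',\mathfrak{Z})$ is the weak star topology on $\mathfrak{Z}'$, i.e. the coarsest topology making all maps $z'\mapsto\langle z',z\rangle$, $z\in\mathfrak{Z}$, continuous. For a $\sigma$-finite measure space $(M,\mathcal{M},\mu)$, a map $\psi:M\to\mathfrak{Z}'$ is $\mathfrak{Z}'$-Gelfand $\mu$-integrable if $x\mapsto\langle\psi(x),z\rangle\in L^1(\mu)$ for every $z\in\mathfrak{Z}$. For such $\psi$ and $E\in\mathcal{M}$, the Gelfand integral $\int_E\psi(x)\,\mu(dx)$ is the element of $\mathfrak{Z}'$ given by $z\mapsto\int_E\langle\psi(x),z\rangle\,\mu(dx)$ (this functional is continuous). Let $\mathcal{F}(M,\mathfrak{Z}')$ be the set of maps from $M$ to $\mathfrak{Z}'$. Given a measurable space $(M,\mathcal{M})$, a map $\xi:\mathcal{M}\to\mathfrak{Z}'$ is an integrator (with measure $\mu$ and map $\Xi$) if there exist a $\sigma$-finite measure $\mu$ on $(M,\mathcal{M})$, a map $\Xi:\mathcal{F}(M,\mathfrak{Z}')\to\mathcal{F}(M,\mathfrak{Z}')$, and an element $u\in\mathfrak{Z}'$ (the unit element, regarded as the constant map $x\mapsto u$) such that $\Xi(u)$ is $\mathfrak{Z}'$-Gelfand $\mu$-integrable and $\xi(E)=\int_E\Xi(u)(x)\,\mu(dx)$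 for all $E\in\mathcal{M}$. A map $\gamma:M\to\mathfrak{Z}'$ is integrable with respect to $\xi$, written $\gamma\in\mathcal{I}(\xi)$, if $\Xi(\gamma)$ is $\mathfrak{Z}'$-Gelfand $\mu$-integrable; then for $E\in\mathcal{M}$, $\int_E\gamma(x)\,d\xi(x):=\int_E\Xi(\gamma)(x)\,\mu(dx)\in\mathfrak{Z}'$. *)

theory Defs
  imports "HOL-Analysis.Analysis"
begin

(* The scalar field F, which is the real or the complex numbers. The axiom says that the field is
   either R itself or C (j being an imaginary unit); the superclasses supply its usual absolute
   value and topology. *)
class real_or_complex = real_normed_field + euclidean_space +
  assumes real_or_complex:
    "(\<forall>x. \<exists>a. x = a *\<^sub>R 1) \<or> (\<exists>j. j * j = - 1 \<and> (\<forall>x. \<exists>a b. x = a *\<^sub>R 1 + b *\<^sub>R j))"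

instance real :: real_or_complex
  by standard auto

instance complex :: real_or_complex
proof
  have "\<exists>a b. x = a *\<^sub>R 1 + b *\<^sub>R \<i>" for x :: complex
    by (rule exI[of _ "Re x"], rule exI[of _ "Im x"]) (simp add: complex_eq_iff)
  then show "(\<forall>x::complex. \<exists>a. x = a *\<^sub>R 1) \<or>
      (\<exists>j::complex. j * j = - 1 \<and> (\<forall>x. \<exists>a b. x = a *\<^sub>R 1 + b *\<^sub>R j))"
    using i_squared by blast
qed

(* Addition and negation are continuous by the sort of 'z, which also forces the uniformity of 'z to
   be the translation-invariant one (see the characterisation of the uniformity as a filtercomap of
   nhds 0 in HOL-Analysis.Product_Vector). So complete UNIV is completeness as a topological vector
   space: every Cauchy filter converges. *)
locale frechet_space = vector_space smul
  for smul :: "'f::real_or_complex \<Rightarrow> 'z::{ab_group_add, uniform_topological_group_add} \<Rightarrow> 'z" +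
  assumes continuous_smul: "continuous_on UNIV (\<lambda>(a, z). smul a z)"
    and locally_convex: "\<And>U. open U \<Longrightarrow> 0 \<in> U \<Longrightarrow>
      \<exists>C. open C \<and> 0 \<in> C \<and> C \<subseteq> U \<and>
        (\<forall>x\<in>C. \<forall>y\<in>C. \<forall>t\<in>{0..1}. smul (of_real t) x + smul (of_real (1 - t)) y \<in> C)"
    and metrizable: "metrizable_space (euclidean :: 'z topology)"
    and complete: "complete (UNIV :: 'z set)"

definition dual ::
    "('f::real_or_complex \<Rightarrow> 'z::{ab_group_add, topological_space} \<Rightarrow> 'z) \<Rightarrow> ('z \<Rightarrow> 'f) set" where
  "dual smul = {f. Vector_Spaces.linear smul (*) f \<and> continuous_on UNIV f}"

(* The coarsest topology on the dual making all evaluations f \<mapsto> f z continuous. *)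
definition weak_star ::
    "('f::real_or_complex \<Rightarrow> 'z::{ab_group_add, topological_space} \<Rightarrow> 'z) \<Rightarrow> ('z \<Rightarrow> 'f) topology" where
  "weak_star smul = topology_generated_by {{f \<in> dual smul. f z \<in> U} |z U. open U}"

definition gelfand_integrable ::
    "('f::real_or_complex \<Rightarrow> 'z::{ab_group_add, topological_space} \<Rightarrow> 'z)
      \<Rightarrow> 'm measure \<Rightarrow> ('m \<Rightarrow> 'z \<Rightarrow> 'f) \<Rightarrow> bool" where
  "gelfand_integrable smul \<mu> \<psi> \<longleftrightarrow>
    \<psi> \<in> space \<mu> \<rightarrow> dual smul \<and> (\<forall>z. integrable \<mu> (\<lambda>x. \<psi> x z))"

definition gelfand_integral ::
    "'m measure \<Rightarrow> 'm set \<Rightarrow> ('m \<Rightarrow> 'z \<Rightarrow> 'f::real_or_complex) \<Rightarrow> 'z \<Rightarrow> 'f" where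
  "gelfand_integral \<mu> E \<psi> = (\<lambda>z. LINT x:E|\<mu>. \<psi> x z)"

(* Maps defined on the set space M only, represented by functions that are undefined outside it.
   Throughout, M merely stands for a measurable space: its measure is ignored. *)
definition dual_maps ::
    "('f::real_or_complex \<Rightarrow> 'z::{ab_group_add, topological_space} \<Rightarrow> 'z)
      \<Rightarrow> 'm measure \<Rightarrow> ('m \<Rightarrow> 'z \<Rightarrow> 'f) set" where
  "dual_maps smul M = space M \<rightarrow>\<^sub>E dual smul"

definition integrator ::
    "('f::real_or_complex \<Rightarrow> 'z::{ab_group_add, topological_space} \<Rightarrow> 'z)
      \<Rightarrow> 'm measure \<Rightarrow> ('m set \<Rightarrow> 'z \<Rightarrow> 'f) \<Rightarrow> 'm measure
      \<Rightarrow> (('m \<Rightarrow> 'z \<Rightarrow> 'f) \<Rightarrow> ('m \<Rightarrow> 'z \<Rightarrow> 'f)) \<Rightarrow> bool" where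
  "integrator smul M \<xi> \<mu> \<Xi> \<longleftrightarrow>
    \<xi> \<in> sets M \<rightarrow> dual smul \<and>
    sets \<mu> = sets M \<and> sigma_finite_measure \<mu> \<and>
    \<Xi> \<in> dual_maps smul M \<rightarrow> dual_maps smul M \<and>
    (\<exists>u\<in>dual smul.
      gelfand_integrable smul \<mu> (\<Xi> (\<lambda>x\<in>space M. u)) \<and>
      (\<forall>E\<in>sets M. \<xi> E = gelfand_integral \<mu> E (\<Xi> (\<lambda>x\<in>space M. u))))"

(* The class I(\<xi>) and the integral against \<xi> depend on \<xi> only through the measure \<mu> and the map \<Xi>. *)
definition integrable_maps ::
    "('f::real_or_complex \<Rightarrow> 'z::{ab_group_add, topological_space} \<Rightarrow> 'z)
      \<Rightarrow> 'm measure \<Rightarrow> 'm measure \<Rightarrow> (('m \<Rightarrow> 'z \<Rightarrow> 'f) \<Rightarrow> ('m \<Rightarrow> 'z \<Rightarrow> 'f))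
      \<Rightarrow> ('m \<Rightarrow> 'z \<Rightarrow> 'f) set" where
  "integrable_maps smul M \<mu> \<Xi> = {\<gamma> \<in> dual_maps smul M. gelfand_integrable smul \<mu> (\<Xi> \<gamma>)}"

definition integrator_integral ::
    "'m measure \<Rightarrow> (('m \<Rightarrow> 'z \<Rightarrow> 'f) \<Rightarrow> ('m \<Rightarrow> 'z \<Rightarrow> 'f::real_or_complex))
      \<Rightarrow> 'm set \<Rightarrow> ('m \<Rightarrow> 'z \<Rightarrow> 'f) \<Rightarrow> 'z \<Rightarrow> 'f" where
  "integrator_integral \<mu> \<Xi> E \<gamma> = gelfand_integral \<mu> E (\<Xi> \<gamma>)"

end

theory Submission
  imports Defs
begin

text \<open>
  Weak star convergence in the dual is pointwise convergence (\<open>limitin_weak_star_iff\<close>),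
  so for each vector \<open>z\<close> the claim about integrals is the dominated convergence theorem applied to \<open>x \<mapsto> \<langle>\<Xi> \<gamma>\<^sub>k x, z\<rangle>\<close>. It remains to see
  that the limit functional \<open>z \<mapsto> \<integral>\<langle>\<Xi> \<gamma> x, z\<rangle> d\<mu>\<close> belongs to the dual, that is, that Gelfand integrals
  are continuous functionals (\<open>integral_mem_dual\<close>).

  Continuity is proved by contradiction. If the functional \<open>\<phi> z = \<integral>\<langle>\<psi> x, z\<rangle> d\<mu>\<close> is discontinuous, there
  are vectors \<open>z\<^sub>n\<close> tending to zero as fast as desired with \<open>\<bar>\<phi> z\<^sub>n\<bar> \<ge> e\<close>. Completeness lets every
  subseries \<open>\<Sum>\<^bsub>n\<in>A\<^esub> z\<^sub>n\<close> converge, and fast decay gives \<open>\<Sum>\<^sub>n \<bar>\<langle>\<psi> x, z\<^sub>n\<rangle>\<bar> < \<infinity>\<close> for each \<open>x\<close>. Thus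
  the functions \<open>f\<^sub>n = \<langle>\<psi>(\<cdot>), z\<^sub>n\<rangle>\<close> have all their pointwise subseries sums integrable, and
  \<open>integral_tendsto_0_if_subseries_integrable\<close> yields the contradiction \<open>\<phi> z\<^sub>n = \<integral>f\<^sub>n d\<mu> \<rightarrow> 0\<close>.

  That lemma is a Baire category argument on the Cantor space of subsets \<open>A\<close> of \<open>\<nat>\<close>. The map
  \<open>G A = \<integral>\<Sum>\<^bsub>n\<in>A\<^esub> f\<^sub>n d\<mu>\<close> is a pointwise limit of continuous maps, namely the integrals over sets on
  which \<open>\<Sum>\<^sub>n \<bar>f\<^sub>n\<bar>\<close> has an integrable bound. Hence \<open>G\<close> oscillates little on some cylinder set
  (\<open>pointwise_limit_small_oscillation\<close>), and switching a late \<open>n\<close> on and off in a member of the cylinder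
  changes \<open>G\<close> by \<open>\<integral>f\<^sub>n d\<mu>\<close>.
\<close>

section \<open>Pointwise limits of continuous maps on Cantor space\<close>

text \<open>
  Subsets of \<open>\<nat>\<close> stand for points of Cantor space; two of them are close when they agree below a
  large \<open>N\<close>. If no \<open>F m\<close> were uniformly close to \<open>G\<close> on a cylinder, then nested cylinders could be
  chosen at whose common point \<open>C\<close> the sequence \<open>F m C\<close> is not Cauchy.
\<close>
lemma pointwise_limit_small_oscillation:
  fixes F :: "nat \<Rightarrow> nat set \<Rightarrow> 'a::real_normed_vector"
  assumes cont: "\<And>m A e. e > 0 \<Longrightarrow>
      \<exists>N. \<forall>B. (\<forall>i<N. i \<in> B \<longleftrightarrow> i \<in> A) \<longrightarrow> norm (F m B - F m A) < e"
    and conv: "\<And>A. (\<lambda>m. F m A) \<longlonglongrightarrow> G A"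
    and e: "e > 0"
  shows "\<exists>A N. \<forall>B. (\<forall>i<N. i \<in> B \<longleftrightarrow> i \<in> A) \<longrightarrow> norm (G B - G A) \<le> e"
proof -
  have "\<exists>A N m. \<forall>B. (\<forall>i<N. i \<in> B \<longleftrightarrow> i \<in> A) \<longrightarrow> norm (F m B - G B) \<le> e / 3"
  proof (rule ccontr)
    assume "\<not> ?thesis"
    then have neg: "\<exists>B. (\<forall>i<N. i \<in> B \<longleftrightarrow> i \<in> A) \<and> e / 3 < norm (F m B - G B)" for A N m
      by (meson not_le)
    \<comment> \<open>From a stage \<open>(A, N, m)\<close> pass to a smaller cylinder, given by \<open>(B, N')\<close>, on all of which some
      \<open>F k\<close> with \<open>k \<ge> m\<close> differs from \<open>F m\<close> by more than \<open>e / 3\<close>.\<close>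
    define Q where "Q = (\<lambda>(A, N, m) (B, N', m'). N < N' \<and> m < m' \<and> (\<forall>i<N. i \<in> B \<longleftrightarrow> i \<in> A) \<and>
      (\<exists>k\<ge>m. \<forall>C. (\<forall>i<N'. i \<in> C \<longleftrightarrow> i \<in> B) \<longrightarrow> e / 3 < norm (F k C - F m C)))"
    have step: "\<exists>y. Q (A, N, m) y" for A and N m :: nat
    proof -
      obtain B where B: "(\<forall>i<N. i \<in> B \<longleftrightarrow> i \<in> A)" "e / 3 < norm (F m B - G B)"
        using neg[of N A m] by metis
      have "(\<lambda>k. norm (F k B - F m B)) \<longlonglongrightarrow> norm (G B - F m B)"
        by (intro tendsto_intros conv)
      then have "eventually (\<lambda>k. e / 3 < norm (F k B - F m B)) sequentially"
        by (rule order_tendstoD) (use B(2) in \<open>simp add: norm_minus_commute\<close>)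
      then obtain k where k: "k \<ge> m" "e / 3 < norm (F k B - F m B)"
        using eventually_happens[OF eventually_conj[OF eventually_ge_at_top[of m]]] by auto
      define d where "d = (norm (F k B - F m B) - e / 3) / 2"
      have "d > 0" using k(2) by (simp add: d_def)
      obtain N1 where N1: "\<And>C. (\<forall>i<N1. i \<in> C \<longleftrightarrow> i \<in> B) \<Longrightarrow> norm (F k C - F k B) < d"
        using cont[OF \<open>d > 0\<close>, of B k] by auto
      obtain N2 where N2: "\<And>C. (\<forall>i<N2. i \<in> C \<longleftrightarrow> i \<in> B) \<Longrightarrow> norm (F m C - F m B) < d"
        using cont[OF \<open>d > 0\<close>, of B m] by auto
      define N' where "N' = Suc (N + N1 + N2)"
      have "e / 3 < norm (F k C - F m C)" if "(\<forall>i<N'. i \<in> C \<longleftrightarrow> i \<in> B)" for C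
      proof -
        have "norm (F k C - F k B) < d" "norm (F m C - F m B) < d"
          using that by (simp_all add: N1 N2 N'_def)
        moreover have "norm (F k B - F m B) \<le>
            norm (F k C - F m C) + norm (F k C - F k B) + norm (F m C - F m B)"
          using norm_triangle_ineq4[of "F k C - F m C" "(F k C - F k B) - (F m C - F m B)"]
            norm_triangle_ineq4[of "F k C - F k B" "F m C - F m B"]
          by (simp add: algebra_simps)
        ultimately show ?thesis by (simp add: d_def field_simps)
      qed
      then have "Q (A, N, m) (B, N', Suc m)"
        using B(1) k(1) by (auto simp: Q_def N'_def)
      then show ?thesis by blast
    qed
    have "\<exists>y. Q x y" for x
      by (cases x rule: prod_cases3) (use step in simp)
    then obtain s where s: "\<And>j. Q (s j) (s (Suc j))"
      using dependent_nat_choice[of "\<lambda>_ _. True" "\<lambda>_. Q"] by auto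
    define A N M where "A = (\<lambda>j. fst (s j))" and "N = (\<lambda>j. fst (snd (s j)))"
      and "M = (\<lambda>j. snd (snd (s j)))"
    have s_eq: "s j = (A j, N j, M j)" for j
      by (simp add: A_def N_def M_def)
    have Q: "N j < N (Suc j)" "M j < M (Suc j)" "(\<forall>i<N j. i \<in> A (Suc j) \<longleftrightarrow> i \<in> A j)"
      "\<exists>k\<ge>M j. \<forall>C. (\<forall>i<N (Suc j). i \<in> C \<longleftrightarrow> i \<in> A (Suc j)) \<longrightarrow>
         e / 3 < norm (F k C - F (M j) C)" for j
      using s[of j] unfolding s_eq Q_def by auto
    have N_mono: "strict_mono N" and M_mono: "strict_mono M"
      using Q by (auto simp: strict_mono_Suc_iff)
    have agree: "i \<in> A (j + l) \<longleftrightarrow> i \<in> A j" if "i < N j" for i j l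
    proof (induction l)
      case (Suc l)
      have "i < N (j + l)"
        using that strict_mono_less_eq[OF N_mono, of j "j + l"] by simp
      then show ?case using Q(3)[of "j + l"] Suc by simp
    qed simp
    \<comment> \<open>The point common to all the cylinders: \<open>i < N (Suc i)\<close>, so stage \<open>Suc i\<close> decides on \<open>i\<close>.\<close>
    define C where "C = {i. i \<in> A (Suc i)}"
    have C: "(\<forall>i<N j. i \<in> C \<longleftrightarrow> i \<in> A j)" for j
    proof -
      have "i \<in> A (Suc i) \<longleftrightarrow> i \<in> A j" if "i < N j" for i
      proof -
        have "i < N (Suc i)"
          using seq_suble[OF N_mono, of "Suc i"] by simp
        then have "i \<in> A (Suc i + j) \<longleftrightarrow> i \<in> A (Suc i)" by (rule agree)
        with agree[OF that, of "Suc i"] show ?thesis by (simp add: add.commute)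
      qed
      then show ?thesis by (auto simp: C_def)
    qed
    have "Cauchy (\<lambda>m. F m C)" using conv by (rule LIMSEQ_imp_Cauchy)
    then obtain K where K: "\<And>m n. m \<ge> K \<Longrightarrow> n \<ge> K \<Longrightarrow> norm (F m C - F n C) < e / 3"
      using CauchyD[of "\<lambda>m. F m C" "e / 3"] e by auto
    obtain k where "k \<ge> M K" "e / 3 < norm (F k C - F (M K) C)"
      using Q(4)[of K] C by blast
    with K[of k "M K"] seq_suble[OF M_mono, of K] show False by force
  qed
  then obtain A N m where
    N: "\<And>B. (\<forall>i<N. i \<in> B \<longleftrightarrow> i \<in> A) \<Longrightarrow> norm (F m B - G B) \<le> e / 3" by blast
  obtain N' where N': "\<And>B. (\<forall>i<N'. i \<in> B \<longleftrightarrow> i \<in> A) \<Longrightarrow> norm (F m B - F m A) < e / 3"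
    using cont[of "e / 3" A m] e by auto
  have "norm (G B - G A) \<le> e" if "(\<forall>i<max N N'. i \<in> B \<longleftrightarrow> i \<in> A)" for B
  proof -
    have "norm (F m B - G B) \<le> e / 3" "norm (F m B - F m A) < e / 3" "norm (F m A - G A) \<le> e / 3"
      using that N[of B] N'[of B] N[of A] by (simp_all add: less_max_iff_disj)
    moreover have "norm (G B - G A) \<le>
        norm (F m B - F m A) + norm (F m B - G B) + norm (F m A - G A)"
      using norm_triangle_ineq[of "(F m B - F m A) - (F m B - G B)" "F m A - G A"]
        norm_triangle_ineq4[of "F m B - F m A" "F m B - G B"] by (simp add: algebra_simps)
    ultimately show ?thesis by linarith
  qed
  then show ?thesis by blast
qed

section \<open>Subseries of integrable functions\<close>

lemma (in sigma_finite_measure) integral_tendsto_0_if_subseries_integrable: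
  fixes f :: "'a \<Rightarrow> nat \<Rightarrow> 'b::{banach, second_countable_topology}"
  assumes summable: "\<And>x. x \<in> space M \<Longrightarrow> summable (\<lambda>n. norm (f x n))"
    and int: "\<And>A. integrable M (\<lambda>x. \<Sum>n. if n \<in> A then f x n else 0)"
  shows "(\<lambda>n. \<integral>x. f x n \<partial>M) \<longlonglongrightarrow> 0"
proof -
  define u where "u A x = (\<Sum>n. if n \<in> A then f x n else 0)" for A x
  define g where "g x = (\<Sum>n. norm (f x n))" for x
  have u_int: "integrable M (u A)" for A
    using int[of A] by (simp add: u_def[abs_def])
  have u_single: "u {n} x = f x n" for n x
    using suminf_finite[of "{n}" "\<lambda>i. if i \<in> {n} then f x i else 0"] by (simp add: u_def)
  have f_int: "integrable M (\<lambda>x. f x n)" for n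
    using u_int[of "{n}"] by (simp add: u_single[abs_def])
  have f_meas[measurable]: "(\<lambda>x. f x n) \<in> borel_measurable M" for n
    using f_int by simp
  have u_meas[measurable]: "u A \<in> borel_measurable M" for A
    using u_int by simp
  have g_meas[measurable]: "g \<in> borel_measurable M"
    unfolding g_def[abs_def] by measurable
  have sub_norm: "summable (\<lambda>n. norm (if n \<in> A then f x n else 0))" if "x \<in> space M" for A x
    by (rule summable_comparison_test'[OF summable[OF that]]) auto
  have sub: "summable (\<lambda>n. if n \<in> A then f x n else 0)" if "x \<in> space M" for A x
    using sub_norm[OF that] by (rule summable_norm_cancel)
  obtain h :: "'a \<Rightarrow> real" where h[measurable]: "h \<in> borel_measurable M"
    and h_pos: "\<And>x. h x > 0" and h_int: "integrable M h"
    using obtain_positive_integrable_function by blast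
  \<comment> \<open>The sets \<open>S m\<close> exhaust the space because \<open>h\<close> is positive, and on each of them the series of
    norms is dominated by an integrable function.\<close>
  define S where "S m = {x \<in> space M. g x \<le> real m * h x}" for m
  have S[measurable]: "S m \<in> sets M" for m
    unfolding S_def by measurable
  define F where "F m A = (\<integral>x. indicator (S m) x *\<^sub>R u A x \<partial>M)" for m A
  define G where "G A = (\<integral>x. u A x \<partial>M)" for A
  have ind_int: "integrable M (\<lambda>x. indicator (S m) x *\<^sub>R u A x)" for m A
    using S u_int by (rule integrable_mult_indicator)
  have conv: "(\<lambda>m. F m A) \<longlonglongrightarrow> G A" for A
    unfolding F_def G_def
  proof (rule integral_dominated_convergence)
    show "integrable M (\<lambda>x. norm (u A x))" using u_int by simp
    show "AE x in M. (\<lambda>m. indicator (S m) x *\<^sub>R u A x) \<longlonglongrightarrow> u A x"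
    proof (rule AE_I2)
      fix x assume x: "x \<in> space M"
      obtain m0 :: nat where m0: "g x / h x \<le> m0" using real_arch_simple by blast
      have "x \<in> S m" if "m \<ge> m0" for m
      proof -
        have "g x / h x \<le> m" using m0 that by linarith
        then show ?thesis using x h_pos[of x] by (simp add: S_def field_simps)
      qed
      then have "eventually (\<lambda>m. u A x = indicator (S m) x *\<^sub>R u A x) sequentially"
        by (auto simp: eventually_sequentially intro!: exI[of _ m0])
      then show "(\<lambda>m. indicator (S m) x *\<^sub>R u A x) \<longlonglongrightarrow> u A x"
        by (rule Lim_transform_eventually[OF tendsto_const])
    qed
    show "AE x in M. norm (indicator (S m) x *\<^sub>R u A x) \<le> norm (u A x)" for m
      by (auto simp: indicator_def)
  qed measurable
  have cont: "\<exists>N. \<forall>B. (\<forall>i<N. i \<in> B \<longleftrightarrow> i \<in> A) \<longrightarrow> norm (F m B - F m A) < e"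
    if e: "e > 0" for m A e
  proof -
    define r where "r N x = indicator (S m) x * (\<Sum>n. norm (f x (n + N)))" for N x
    have tail_le: "(\<Sum>n. norm (f x (n + N))) \<le> g x" and tail_nonneg: "0 \<le> (\<Sum>n. norm (f x (n + N)))"
      if "x \<in> space M" for x N
      unfolding g_def using suminf_split_initial_segment[OF summable[OF that], of N]
        sum_nonneg[of "{..<N}" "\<lambda>n. norm (f x n)"]
        suminf_nonneg[OF summable_ignore_initial_segment[OF summable[OF that], of N]] by auto
    have r_le: "norm (r N x) \<le> real m * h x" if x: "x \<in> space M" for N x
      using tail_le[OF x, of N] tail_nonneg[OF x, of N] h_pos[of x]
      by (auto simp: r_def S_def indicator_def)
    have r_meas[measurable]: "r N \<in> borel_measurable M" for N
      unfolding r_def[abs_def] by measurable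
    have mh: "integrable M (\<lambda>x. real m * h x)" using h_int by simp
    have r_int: "integrable M (r N)" for N
    proof (rule Bochner_Integration.integrable_bound[OF mh])
      show "AE x in M. norm (r N x) \<le> norm (real m * h x)"
        using r_le by (intro AE_I2) (auto intro: order_trans[OF _ abs_ge_self])
    qed measurable
    have "(\<lambda>N. \<integral>x. r N x \<partial>M) \<longlonglongrightarrow> (\<integral>x. 0 \<partial>M)"
    proof (rule integral_dominated_convergence[OF _ _ mh])
      show "AE x in M. (\<lambda>N. r N x) \<longlonglongrightarrow> 0"
      proof (rule AE_I2)
        fix x assume "x \<in> space M"
        note s = summable[OF this]
        have "(\<lambda>N. g x - (\<Sum>n<N. norm (f x n))) \<longlonglongrightarrow> g x - g x"
          unfolding g_def by (intro tendsto_intros summable_LIMSEQ s)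
        then have "(\<lambda>N. \<Sum>n. norm (f x (n + N))) \<longlonglongrightarrow> 0"
          using suminf_minus_initial_segment[OF s] by (simp add: g_def)
        then show "(\<lambda>N. r N x) \<longlonglongrightarrow> 0"
          unfolding r_def by (rule tendsto_mult_right_zero)
      qed
    qed (use r_le in auto)
    then have "eventually (\<lambda>N. (\<integral>x. r N x \<partial>M) < e) sequentially"
      using e by (auto intro: order_tendstoD)
    then obtain N where N: "(\<integral>x. r N x \<partial>M) < e"
      by (auto simp: eventually_sequentially)
    have "norm (F m B - F m A) < e" if agree: "(\<forall>i<N. i \<in> B \<longleftrightarrow> i \<in> A)" for B
    proof -
      have le: "norm (indicator (S m) x *\<^sub>R u B x - indicator (S m) x *\<^sub>R u A x) \<le> r N x"
        if x: "x \<in> space M" for x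
      proof -
        have head: "(\<Sum>n<N. if n \<in> B then f x n else 0) = (\<Sum>n<N. if n \<in> A then f x n else 0)"
          using agree by (intro sum.cong) auto
        have "u B x - u A x = (\<Sum>n. if n + N \<in> B then f x (n + N) else 0)
            - (\<Sum>n. if n + N \<in> A then f x (n + N) else 0)"
          unfolding u_def suminf_split_initial_segment[OF sub[OF x], of _ N] head by simp
        also have "\<dots> = (\<Sum>n. (if n + N \<in> B then f x (n + N) else 0)
            - (if n + N \<in> A then f x (n + N) else 0))"
          by (intro suminf_diff summable_ignore_initial_segment[of "\<lambda>n. if n \<in> _ then f x n else 0"]
              sub[OF x])
        also have "norm \<dots> \<le> (\<Sum>n. norm (f x (n + N)))"
          by (rule norm_suminf_le[OF _ summable_ignore_initial_segment[OF summable[OF x]]]) auto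
        finally show ?thesis by (auto simp: r_def indicator_def)
      qed
      have "norm (F m B - F m A)
          = norm (\<integral>x. indicator (S m) x *\<^sub>R u B x - indicator (S m) x *\<^sub>R u A x \<partial>M)"
        unfolding F_def by (simp only: Bochner_Integration.integral_diff[OF ind_int ind_int])
      also have "\<dots> \<le> (\<integral>x. r N x \<partial>M)"
        by (rule order_trans[OF integral_norm_bound Bochner_Integration.integral_mono])
          (use le r_int ind_int in auto)
      finally show ?thesis using N by simp
    qed
    then show ?thesis by blast
  qed
  show ?thesis
  proof (rule LIMSEQ_I)
    fix e :: real assume "0 < e"
    then obtain A N where N: "\<And>B. (\<forall>i<N. i \<in> B \<longleftrightarrow> i \<in> A) \<Longrightarrow> norm (G B - G A) \<le> e / 3"
      using pointwise_limit_small_oscillation[of F G "e / 3", OF cont conv] by auto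
    have "norm ((\<integral>x. f x n \<partial>M) - 0) < e" if n: "n \<ge> N" for n
    proof -
      have flip: "f x n = u (insert n A) x - u (A - {n}) x" if x: "x \<in> space M" for x
      proof -
        have "u (insert n A) x - u (A - {n}) x
            = (\<Sum>i. (if i \<in> insert n A then f x i else 0) - (if i \<in> A - {n} then f x i else 0))"
          unfolding u_def by (intro suminf_diff sub[OF x])
        also have "\<dots> = u {n} x"
          unfolding u_def by (rule arg_cong[where f = suminf]) auto
        finally show ?thesis by (simp add: u_single)
      qed
      have "(\<integral>x. f x n \<partial>M) = G (insert n A) - G (A - {n})"
        unfolding G_def Bochner_Integration.integral_diff[OF u_int u_int, symmetric]
        by (intro Bochner_Integration.integral_cong) (auto simp: flip)
      also have "\<dots> = (G (insert n A) - G A) - (G (A - {n}) - G A)" by simp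
      also have "norm \<dots> \<le> e / 3 + e / 3"
        by (intro norm_triangle_le_diff add_mono N) (use n in auto)
      finally show ?thesis using \<open>0 < e\<close> by simp
    qed
    then show "\<exists>no. \<forall>n\<ge>no. norm ((\<integral>x. f x n \<partial>M) - 0) < e" by blast
  qed
qed

section \<open>The weak star topology\<close>

lemma limitin_weak_star_iff:
  assumes "eventually (\<lambda>k. f k \<in> dual smul) F"
  shows "limitin (weak_star smul) f l F \<longleftrightarrow> l \<in> dual smul \<and> (\<forall>z. ((\<lambda>k. f k z) \<longlongrightarrow> l z) F)"
proof -
  let ?B = "{{f \<in> dual smul. f z \<in> U} | z U. open U}"
  have "dual smul = {f \<in> dual smul. f z \<in> UNIV}" for z by simp
  then have top: "topspace (weak_star smul) = dual smul"
    unfolding weak_star_def topology_generated_by_topspace by auto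
  show ?thesis
  proof (intro iffI conjI allI)
    assume lim: "limitin (weak_star smul) f l F"
    then show l: "l \<in> dual smul" by (metis limitin_topspace top)
    fix z
    show "((\<lambda>k. f k z) \<longlongrightarrow> l z) F"
    proof (rule topological_tendstoI)
      fix U assume U: "open U" "l z \<in> U"
      have "openin (weak_star smul) {f \<in> dual smul. f z \<in> U}"
        unfolding weak_star_def by (rule topology_generated_by_Basis) (use U in blast)
      then have "eventually (\<lambda>k. f k \<in> {f \<in> dual smul. f z \<in> U}) F"
        using lim l U unfolding limitin_def by blast
      then show "eventually (\<lambda>k. f k z \<in> U) F"
        by (rule eventually_mono) simp
    qed
  next
    assume lim: "l \<in> dual smul \<and> (\<forall>z. ((\<lambda>k. f k z) \<longlongrightarrow> l z) F)"
    have ev: "eventually (\<lambda>k. f k \<in> W) F" if "generate_topology_on ?B W" "l \<in> W" for W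
      using that
    proof (induction rule: generate_topology_on.induct)
      case (Int a b)
      then show ?case by (auto intro: eventually_elim2)
    next
      case (UN K)
      then obtain k where "k \<in> K" "l \<in> k" by blast
      with UN have "eventually (\<lambda>i. f i \<in> k) F" by blast
      then show ?case by (rule eventually_mono) (use \<open>k \<in> K\<close> in blast)
    next
      case (Basis s)
      then obtain z U where s: "s = {f \<in> dual smul. f z \<in> U}" "open U" by blast
      with Basis have "eventually (\<lambda>k. f k z \<in> U) F"
        using lim by (auto intro: topological_tendstoD)
      with assms show ?case by eventually_elim (simp add: s)
    qed simp
    show "limitin (weak_star smul) f l F"
      unfolding limitin_def top
      using lim ev by (auto simp: weak_star_def openin_topology_generated_by_iff)
  qed
qed

lemma dualD:
  assumes "f \<in> dual smul"
  shows "f (x + y) = f x + f y" "f (smul c x) = c * f x" "f 0 = 0"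
    "f (\<Sum>i\<in>I. w i) = (\<Sum>i\<in>I. f (w i))" "continuous_on UNIV f"
proof -
  interpret Vector_Spaces.linear smul "(*)" f
    using assms by (simp add: dual_def)
  show "f (x + y) = f x + f y" "f (smul c x) = c * f x" "f 0 = 0"
    "f (\<Sum>i\<in>I. w i) = (\<Sum>i\<in>I. f (w i))"
    by (rule add scale zero sum)+
  show "continuous_on UNIV f"
    using assms by (simp add: dual_def)
qed

section \<open>Rapidly converging series\<close>

text \<open>
  A neighbourhood base \<open>V 0, V 1, \<dots>\<close> of zero consisting of open sets such that the sum of two elements of
  \<open>V (Suc n)\<close> is in \<open>V n\<close>; as \<open>0\<close> lies in each set, the sequence is decreasing. It replaces balls
  of radius \<open>2\<^bsup>-n\<^esup>\<close> and makes no reference to scalars.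
\<close>
definition nested_zero_base :: "(nat \<Rightarrow> 'z::{ab_group_add, topological_space} set) \<Rightarrow> bool" where
  "nested_zero_base V \<longleftrightarrow>
    (\<forall>n. open (V n) \<and> 0 \<in> V n \<and> (\<forall>x\<in>V (Suc n). \<forall>y\<in>V (Suc n). x + y \<in> V n)) \<and>
    (\<forall>W. open W \<longrightarrow> 0 \<in> W \<longrightarrow> (\<exists>n. V n \<subseteq> W))"

lemma nested_zero_baseD:
  assumes "nested_zero_base V"
  shows "open (V n)" "0 \<in> V n" "x \<in> V (Suc n) \<Longrightarrow> y \<in> V (Suc n) \<Longrightarrow> x + y \<in> V n"
    "open W \<Longrightarrow> 0 \<in> W \<Longrightarrow> \<exists>n. V n \<subseteq> W"
  using assms by (auto simp: nested_zero_base_def)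

lemma nested_zero_base_antimono:
  assumes V: "nested_zero_base V" and "m \<le> n"
  shows "V n \<subseteq> V m"
proof -
  have "V (Suc n) \<subseteq> V n" for n
    using nested_zero_baseD(3)[OF V _ nested_zero_baseD(2)[OF V]] by fastforce
  then show ?thesis using \<open>m \<le> n\<close> by (rule lift_Suc_antimono_le)
qed

text \<open>The analogue of \<open>\<Sum>\<^bsub>i>m\<^esub> 2\<^bsup>-i\<^esup> = 2\<^bsup>-m\<^esup>\<close>: blocks of the series are small.\<close>
lemma sum_mem_zero_neighbourhood:
  assumes V: "nested_zero_base V" and c: "\<And>n. c n \<in> V n"
  shows "(\<Sum>i\<in>{Suc m..<Suc m + k}. c i) \<in> V m"
proof (induction k arbitrary: m)
  case (Suc k)
  have "(\<Sum>i\<in>{Suc m..<Suc m + Suc k}. c i) = c (Suc m) + (\<Sum>i\<in>{Suc (Suc m)..<Suc (Suc m) + k}. c i)"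
    by (subst sum.atLeast_Suc_lessThan) auto
  then show ?case
    using nested_zero_baseD(3)[OF V c Suc[of "Suc m"]] by simp
qed (simp add: nested_zero_baseD(2)[OF V])

context frechet_space
begin

lemma nested_zero_base_exists:
  obtains V :: "nat \<Rightarrow> 'z set" where "nested_zero_base V"
proof -
  obtain X :: "'z set" and d where X: "Metric_space X d" "euclidean = Metric_space.mtopology X d"
    using metrizable unfolding metrizable_space_def by metis
  interpret Metric_space X d by (rule X(1))
  have openin_eq: "openin mtopology = open"
    unfolding X(2)[symmetric] by (simp add: fun_eq_iff)
  have X_UNIV: "X = UNIV"
    using X(2) topspace_mtopology by (metis topspace_euclidean)
  define U where "U n = mball 0 (inverse (real (Suc n)))" for n
  have U: "open (U n)" "0 \<in> U n" for n
  proof -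
    show "open (U n)"
      unfolding U_def by (subst openin_eq[symmetric]) (rule openin_mball)
    have "(0 :: 'z) \<in> X" using X_UNIV by blast
    then show "0 \<in> U n" by (simp add: U_def)
  qed
  have U_base: "\<exists>n. U n \<subseteq> W" if W: "open W" "0 \<in> W" for W
  proof -
    obtain r where r: "r > 0" "mball 0 r \<subseteq> W"
      using W openin_mtopology[of W] unfolding openin_eq by blast
    obtain n where "inverse (real (Suc n)) < r"
      using reals_Archimedean[OF r(1)] by blast
    then have "U n \<subseteq> mball 0 r" unfolding U_def by (intro mball_subset_concentric) simp
    with r show ?thesis by blast
  qed
  have "\<exists>V. \<forall>n. (open (V n) \<and> 0 \<in> V n) \<and>
      (V (Suc n) \<subseteq> U n \<and> (\<forall>x\<in>V (Suc n). \<forall>y\<in>V (Suc n). x + y \<in> V n))"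
  proof (rule dependent_nat_choice)
    show "\<exists>W :: 'z set. open W \<and> 0 \<in> W" by blast
    fix V :: "'z set" and n
    assume V: "open V \<and> 0 \<in> V"
    have "((\<lambda>p. fst p + snd p) \<longlongrightarrow> 0 + 0) (nhds (0 :: 'z) \<times>\<^sub>F nhds 0)"
      by (rule tendsto_add_Pair)
    then have "eventually (\<lambda>p. fst p + snd p \<in> V) (nhds (0 :: 'z) \<times>\<^sub>F nhds 0)"
      using V by (intro topological_tendstoD) auto
    then obtain P Q where P: "eventually P (nhds (0 :: 'z))" and Q: "eventually Q (nhds (0 :: 'z))"
      and PQ: "\<And>x y. P x \<Longrightarrow> Q y \<Longrightarrow> x + y \<in> V"
      unfolding eventually_prod_filter by auto
    obtain A B where A: "open A" "0 \<in> A" "\<And>x. x \<in> A \<Longrightarrow> P x"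
      and B: "open B" "0 \<in> B" "\<And>x. x \<in> B \<Longrightarrow> Q x"
      using P Q unfolding eventually_nhds by metis
    show "\<exists>W. (open W \<and> 0 \<in> W) \<and> (W \<subseteq> U n \<and> (\<forall>x\<in>W. \<forall>y\<in>W. x + y \<in> V))"
      using A B U[of n] PQ by (intro exI[of _ "A \<inter> B \<inter> U n"]) auto
  qed
  then obtain V where V: "\<forall>n. (open (V n) \<and> 0 \<in> V n) \<and>
      (V (Suc n) \<subseteq> U n \<and> (\<forall>x\<in>V (Suc n). \<forall>y\<in>V (Suc n). x + y \<in> V n))"
    by (rule exE)
  have "\<exists>n. V n \<subseteq> W" if W: "open W" "0 \<in> W" for W
  proof -
    obtain n where "U n \<subseteq> W" using U_base[OF W] by (rule exE)
    moreover have "V (Suc n) \<subseteq> U n" using V by simp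
    ultimately have "V (Suc n) \<subseteq> W" by (rule order_trans[rotated])
    then show ?thesis by (rule exI)
  qed
  with V show ?thesis
    by (intro that[of V]) (simp add: nested_zero_base_def)
qed

lemma summable_if_mem_nested_zero_base:
  fixes V :: "nat \<Rightarrow> 'z set"
  assumes V: "nested_zero_base V" and c: "\<And>n. c n \<in> V n"
  shows "summable c"
proof -
  let ?s = "\<lambda>n. \<Sum>i<n. c i"
  have "Cauchy ?s"
    unfolding Cauchy_uniform_iff
  proof (intro allI impI)
    fix P :: "'z \<times> 'z \<Rightarrow> bool"
    assume "eventually P uniformity"
    then obtain W where W: "open W" "0 \<in> W" "\<And>x y. y - x \<in> W \<Longrightarrow> P (x, y)"
      unfolding cauchy_seq_finset_iff_vanishing eventually_filtercomap eventually_nhds by fastforce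
    have "open ((\<lambda>x. - x) -` W \<inter> W)"
      using W(1) by (intro open_Int open_vimage continuous_intros) auto
    then obtain m where "V m \<subseteq> (\<lambda>x. - x) -` W \<inter> W"
      using nested_zero_baseD(4)[OF V, of "(\<lambda>x. - x) -` W \<inter> W"] W(2) by auto
    then have m: "x \<in> W" "- x \<in> W" if "x \<in> V m" for x
      using that by auto
    have diff: "?s q - ?s p \<in> V m" if "Suc m \<le> p" "p \<le> q" for p q
    proof -
      \<comment> \<open>Zero is in every \<open>V i\<close>, so the sum from \<open>p\<close> on may be started at \<open>Suc m\<close>.\<close>
      define b where "b i = (if i < p then 0 else c i)" for i
      have "b i \<in> V i" for i using nested_zero_baseD(2)[OF V] c by (simp add: b_def)
      then have "(\<Sum>i\<in>{Suc m..<Suc m + (q - Suc m)}. b i) \<in> V m"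
        by (rule sum_mem_zero_neighbourhood[OF V])
      also have "(\<Sum>i\<in>{Suc m..<Suc m + (q - Suc m)}. b i) = (\<Sum>i\<in>{p..<q}. c i)"
        using that by (intro sum.mono_neutral_cong_right) (auto simp: b_def)
      also have "\<dots> = ?s q - ?s p"
        using sum_diff_nat_ivl[of 0 p q c] that by (simp add: lessThan_atLeast0)
      finally show ?thesis .
    qed
    have "P (?s p, ?s q)" if "p \<ge> Suc m" "q \<ge> Suc m" for p q
    proof (cases "p \<le> q")
      case True
      then show ?thesis using W(3) m(1) diff that by blast
    next
      case False
      then have "- (?s p - ?s q) \<in> W" using that by (intro m(2) diff) auto
      then show ?thesis using W(3) by simp
    qed
    then show "\<exists>N. \<forall>p\<ge>N. \<forall>q\<ge>N. P (?s p, ?s q)" by blast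
  qed
  then obtain l where "filtermap ?s sequentially \<le> nhds l"
    using cauchy_filter_complete_converges[OF _ complete, of "filtermap ?s sequentially"]
    by (auto simp: Cauchy_uniform filtermap_bot_iff)
  then show ?thesis
    by (auto simp: summable_def sums_def filterlim_def)
qed

text \<open>
  Since \<open>z n\<close> lies in \<open>V (n + n)\<close>, even \<open>2\<^bsup>n\<^esup> z n\<close> lies in \<open>V n\<close>, where the functional is bounded by \<open>1\<close> once
  \<open>n\<close> is large. So the series is dominated by a geometric one.
\<close>
lemma summable_norm_dual_if_rapidly_decreasing:
  fixes V :: "nat \<Rightarrow> 'z set"
  assumes V: "nested_zero_base V" and z: "\<And>n. z n \<in> V (n + n)" and f: "f \<in> dual smul"
  shows "summable (\<lambda>n. norm (f (z n)))"
proof -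
  have pow: "smul (2 ^ k) x \<in> V n" if "x \<in> V (n + k)" for k n x
    using that
  proof (induction k arbitrary: n)
    case (Suc k)
    have "smul (2 ^ k) x \<in> V (Suc n)" using Suc by simp
    then have "smul (2 ^ k) x + smul (2 ^ k) x \<in> V n" by (intro nested_zero_baseD(3)[OF V])
    then show ?case by (simp flip: scale_left_distrib)
  qed simp
  have "open (f -` ball 0 1)"
    using dualD(5)[OF f] by (intro open_vimage) auto
  then obtain N where N: "V N \<subseteq> f -` ball 0 1"
    using nested_zero_baseD(4)[OF V, of "f -` ball 0 1"] dualD(3)[OF f] by auto
  show ?thesis
  proof (rule summable_comparison_test'[of "\<lambda>n. (1 / 2) ^ n" N])
    show "summable (\<lambda>n. (1 / 2 :: real) ^ n)" by (rule summable_geometric) simp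
    fix n assume "n \<ge> N"
    then have "smul (2 ^ n) (z n) \<in> V N"
      using pow[OF z, of n] nested_zero_base_antimono[OF V] by blast
    then have "norm (f (smul (2 ^ n) (z n))) < 1" using N by auto
    then have "2 ^ n * norm (f (z n)) < 1"
      by (simp add: dualD(2)[OF f] norm_mult norm_power)
    then show "norm (norm (f (z n))) \<le> (1 / 2) ^ n"
      by (simp add: power_one_over field_simps)
  qed
qed

section \<open>Continuity of the Gelfand integral\<close>

lemma linear_mem_dualI:
  assumes add: "\<And>x y. f (x + y) = f x + f y" and scale: "\<And>c x. f (smul c x) = c * f x"
    and cont: "\<And>e. e > 0 \<Longrightarrow> \<exists>W. open W \<and> 0 \<in> W \<and> (\<forall>w\<in>W. norm (f w) < e)"
  shows "f \<in> dual smul"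
proof -
  have "vector_space ((*) :: 'f \<Rightarrow> 'f \<Rightarrow> 'f)"
    by unfold_locales (simp_all add: algebra_simps)
  then have "Vector_Spaces.linear smul (*) f"
    using vector_space_axioms by (simp add: Vector_Spaces.linear_iff add scale)
  moreover have "continuous_on UNIV f"
    unfolding continuous_on_def
  proof (intro ballI tendstoI)
    fix x :: 'z and e :: real assume "e > 0"
    from cont[OF \<open>e > 0\<close>] obtain W where W: "open W" "0 \<in> W" "\<And>w. w \<in> W \<Longrightarrow> norm (f w) < e"
      by auto
    have "((\<lambda>y. y - x) \<longlongrightarrow> x - x) (at x)"
      by (intro tendsto_intros)
    then have "eventually (\<lambda>y. y - x \<in> W) (at x)"
      using W by (intro topological_tendstoD) auto
    then show "eventually (\<lambda>y. dist (f y) (f x) < e) (at x)"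
    proof (rule eventually_mono)
      fix y assume "y - x \<in> W"
      then show "dist (f y) (f x) < e"
        using W(3) add[of "y - x" x] by (simp add: dist_norm)
    qed
  qed
  ultimately show ?thesis by (simp add: dual_def)
qed

lemma integral_mem_dual:
  fixes \<psi> :: "'m \<Rightarrow> 'z \<Rightarrow> 'f"
  assumes sf: "sigma_finite_measure \<mu>" and \<psi>: "gelfand_integrable smul \<mu> \<psi>"
  shows "(\<lambda>z. LINT x|\<mu>. \<psi> x z) \<in> dual smul"
proof -
  interpret sigma_finite_measure \<mu> by (rule sf)
  have dual: "\<psi> x \<in> dual smul" if "x \<in> space \<mu>" for x
    using \<psi> that by (auto simp: gelfand_integrable_def)
  have int: "integrable \<mu> (\<lambda>x. \<psi> x z)" for z
    using \<psi> by (simp add: gelfand_integrable_def)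
  define \<phi> where "\<phi> z = (LINT x|\<mu>. \<psi> x z)" for z
  have "\<phi> \<in> dual smul"
  proof (rule linear_mem_dualI)
    show "\<phi> (y + z) = \<phi> y + \<phi> z" for y z
      unfolding \<phi>_def Bochner_Integration.integral_add[OF int int, symmetric]
      by (intro Bochner_Integration.integral_cong) (auto simp: dualD(1)[OF dual])
    show "\<phi> (smul c z) = c * \<phi> z" for c z
    proof -
      have "\<phi> (smul c z) = (LINT x|\<mu>. c * \<psi> x z)"
        unfolding \<phi>_def by (intro Bochner_Integration.integral_cong) (auto simp: dualD(2)[OF dual])
      then show ?thesis by (simp add: \<phi>_def)
    qed
    obtain V :: "nat \<Rightarrow> 'z set" where V: "nested_zero_base V"
      by (rule nested_zero_base_exists)
    fix e :: real assume e: "e > 0"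
    show "\<exists>W. open W \<and> 0 \<in> W \<and> (\<forall>w\<in>W. norm (\<phi> w) < e)"
    proof (rule ccontr)
      assume neg: "\<not> ?thesis"
      have "\<exists>w. w \<in> V (n + n) \<and> norm (\<phi> w) \<ge> e" for n
        using neg nested_zero_baseD(1,2)[OF V] by (meson not_le)
      then obtain z where z: "\<And>n. z n \<in> V (n + n)" "\<And>n. norm (\<phi> (z n)) \<ge> e"
        by metis
      \<comment> \<open>Membership in \<open>V (n + n)\<close> serves pointwise absolute summability; convergence of the
        subseries only needs \<open>V n\<close>.\<close>
      have z_V: "(if n \<in> A then z n else 0) \<in> V n" for n A
        using z(1)[of n] nested_zero_base_antimono[OF V, of n "n + n"] nested_zero_baseD(2)[OF V] by auto
      have "(\<lambda>n. LINT x|\<mu>. \<psi> x (z n)) \<longlonglongrightarrow> 0"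
      proof (rule integral_tendsto_0_if_subseries_integrable)
        show "summable (\<lambda>n. norm (\<psi> x (z n)))" if "x \<in> space \<mu>" for x
          by (rule summable_norm_dual_if_rapidly_decreasing[OF V z(1) dual[OF that]])
        fix A :: "nat set"
        obtain l where l: "(\<lambda>n. if n \<in> A then z n else 0) sums l"
          using summable_if_mem_nested_zero_base[OF V z_V[of _ A]] by (auto simp: summable_def)
        have "(\<Sum>n. if n \<in> A then \<psi> x (z n) else 0) = \<psi> x l" if x: "x \<in> space \<mu>" for x
        proof -
          have "(\<lambda>N. \<psi> x (\<Sum>n<N. if n \<in> A then z n else 0)) \<longlonglongrightarrow> \<psi> x l"
            using dualD(5)[OF dual[OF x]] l
            by (auto simp: sums_def intro: continuous_on_tendsto_compose)
          then have "(\<lambda>n. \<psi> x (if n \<in> A then z n else 0)) sums \<psi> x l"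
            by (simp add: sums_def dualD(4)[OF dual[OF x]])
          moreover have "\<psi> x (if n \<in> A then z n else 0) = (if n \<in> A then \<psi> x (z n) else 0)" for n
            by (simp add: dualD(3)[OF dual[OF x]])
          ultimately show ?thesis by (simp add: sums_iff)
        qed
        then show "integrable \<mu> (\<lambda>x. \<Sum>n. if n \<in> A then \<psi> x (z n) else 0)"
          using int[of l] by (simp cong: Bochner_Integration.integrable_cong)
      qed
      then have "eventually (\<lambda>n. norm (\<phi> (z n)) < e) sequentially"
        using e by (simp add: \<phi>_def tendsto_iff)
      then show False
        using z(2) by (auto simp: eventually_sequentially not_less[symmetric])
    qed
  qed
  then show ?thesis by (simp add: \<phi>_def[abs_def])
qed

end

section \<open>Dominated convergence\<close>

theorem proposition4p13:
  fixes smul :: "'f::real_or_complex \<Rightarrow> 'z::{ab_group_add, uniform_topological_group_add} \<Rightarrow> 'z"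
    and M \<mu> :: "'m measure"
    and \<xi> :: "'m set \<Rightarrow> 'z \<Rightarrow> 'f"
    and \<Xi> :: "('m \<Rightarrow> 'z \<Rightarrow> 'f) \<Rightarrow> ('m \<Rightarrow> 'z \<Rightarrow> 'f)"
    and \<gamma>seq :: "nat \<Rightarrow> 'm \<Rightarrow> 'z \<Rightarrow> 'f"
    and \<gamma> :: "'m \<Rightarrow> 'z \<Rightarrow> 'f"
  assumes "frechet_space smul"
    and "integrator smul M \<xi> \<mu> \<Xi>"
    and "\<And>k. \<gamma>seq k \<in> integrable_maps smul M \<mu> \<Xi>"
    and "\<gamma> \<in> dual_maps smul M"
    and "\<And>z. (\<lambda>x. \<Xi> \<gamma> x z) \<in> borel_measurable \<mu>"
    and "AE x in \<mu>. limitin (weak_star smul) (\<lambda>k. \<Xi> (\<gamma>seq k) x) (\<Xi> \<gamma> x) sequentially"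
    and "\<And>z. \<exists>g :: 'm \<Rightarrow> real. integrable \<mu> g \<and> (AE x in \<mu>. 0 \<le> g x) \<and>
           (\<forall>k. AE x in \<mu>. norm (\<Xi> (\<gamma>seq k) x z) \<le> g x)"
  shows "\<gamma> \<in> integrable_maps smul M \<mu> \<Xi> \<and>
    limitin (weak_star smul) (\<lambda>k. integrator_integral \<mu> \<Xi> (space M) (\<gamma>seq k))
      (integrator_integral \<mu> \<Xi> (space M) \<gamma>) sequentially"
proof -
  interpret frechet_space smul by (rule assms(1))
  have sets_eq: "sets \<mu> = sets M" and sf: "sigma_finite_measure \<mu>"
    and \<Xi>: "\<Xi> \<in> dual_maps smul M \<rightarrow> dual_maps smul M"
    using assms(2) by (auto simp: integrator_def)
  have space_eq: "space \<mu> = space M" using sets_eq by (rule sets_eq_imp_space_eq)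
  have \<Xi>_dual: "\<Xi> \<beta> x \<in> dual smul" if "\<beta> \<in> dual_maps smul M" "x \<in> space \<mu>" for \<beta> x
    using \<Xi> that by (auto simp: dual_maps_def space_eq)
  have seq_maps: "\<gamma>seq k \<in> dual_maps smul M"
    and seq_int: "gelfand_integrable smul \<mu> (\<Xi> (\<gamma>seq k))" for k
    using assms(3)[of k] by (auto simp: integrable_maps_def)
  have seq_meas: "(\<lambda>x. \<Xi> (\<gamma>seq k) x z) \<in> borel_measurable \<mu>" for k z
    using seq_int[of k] by (auto simp: gelfand_integrable_def dest: borel_measurable_integrable)
  have lim: "AE x in \<mu>. (\<lambda>k. \<Xi> (\<gamma>seq k) x z) \<longlonglongrightarrow> \<Xi> \<gamma> x z" for z
    using assms(6) AE_space
  proof eventually_elim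
    case (elim x)
    then have "eventually (\<lambda>k. \<Xi> (\<gamma>seq k) x \<in> dual smul) sequentially"
      using \<Xi>_dual[OF seq_maps] by simp
    from limitin_weak_star_iff[OF this] elim(1) show ?case by blast
  qed
  have dominated: "integrable \<mu> (\<lambda>x. \<Xi> \<gamma> x z)"
    "(\<lambda>k. LINT x|\<mu>. \<Xi> (\<gamma>seq k) x z) \<longlonglongrightarrow> (LINT x|\<mu>. \<Xi> \<gamma> x z)" for z
  proof -
    obtain g where g: "integrable \<mu> g" "\<And>k. AE x in \<mu>. norm (\<Xi> (\<gamma>seq k) x z) \<le> g x"
      using assms(7)[of z] by blast
    show "integrable \<mu> (\<lambda>x. \<Xi> \<gamma> x z)"
      by (rule integrable_dominated_convergence[OF assms(5) seq_meas g(1) lim g(2)])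
    show "(\<lambda>k. LINT x|\<mu>. \<Xi> (\<gamma>seq k) x z) \<longlonglongrightarrow> (LINT x|\<mu>. \<Xi> \<gamma> x z)"
      by (rule integral_dominated_convergence[OF assms(5) seq_meas g(1) lim g(2)])
  qed
  have \<gamma>_int: "gelfand_integrable smul \<mu> (\<Xi> \<gamma>)"
    using dominated(1) \<Xi>_dual[OF assms(4)] by (auto simp: gelfand_integrable_def)
  have integral_eq: "integrator_integral \<mu> \<Xi> (space M) \<beta> = (\<lambda>z. LINT x|\<mu>. \<Xi> \<beta> x z)"
    if "gelfand_integrable smul \<mu> (\<Xi> \<beta>)" for \<beta>
    using that
    by (auto simp: integrator_integral_def gelfand_integral_def gelfand_integrable_def
        space_eq[symmetric] set_integral_space)
  have "limitin (weak_star smul) (\<lambda>k z. LINT x|\<mu>. \<Xi> (\<gamma>seq k) x z)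
      (\<lambda>z. LINT x|\<mu>. \<Xi> \<gamma> x z) sequentially"
    using dominated(2) integral_mem_dual[OF sf seq_int] integral_mem_dual[OF sf \<gamma>_int]
    by (subst limitin_weak_star_iff) auto
  then show ?thesis
    using assms(4) \<gamma>_int seq_int by (simp add: integral_eq integrable_maps_def)
qed

end
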